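(* Let $X$ be a complete bounded metric space and let $E,F$ be Banach spaces. Let $\Xi:X\times E\to F$ be a given function, and define $Sf(x)=\Xi(x,f(x))$ for any function $f:X\to E$. Suppose that $Sf$ belongs to $\operatorname{Lip}(X,F)$ for all $f\in\operatorname{Lip}(X,E)$. Then: (1) If $(x_n)$ is a separated sequence in $X$ and $B$ is a bounded set in $E$, then there is a finite set $N\subseteq\mathbb{N}$ such that $\bigcup_{n\notin N}\Xi(x_n,B)$ is bounded. (2) Suppose that $x_0\in X$, $u_0\in E$ and $C<\infty$. There exist $r>0$ and $D<\infty$ such that $$\|\Xi(x_1,u_1)-\Xi(x_2,u_2)\|\le D\,d(x_1,x_2)$$ whenever $(x_1,u_1),(x_2,u_2)\in X\times E$ satisfy $\|u_1-u_2\|\le C\,d(x_1,x_2)$, $\|u_i-u_0\|\le C\,d(x_i,x_0)$ and $d(x_i,x_0)\le r$, $i=1,2$. (3) Let $(x_n)$ be a separated sequence in $X$ and $(u_n)$ a bounded sequence in $E$. For any $C<\infty$, there exist $r>0$ and $D<\infty$ such that $$\|\Xi(x_n',u_n')-\Xi(x_n,u_n)\|\le D\,d(x_n',x_n)\quad\text{for all }n$$ whenever $(x_n')\subseteq X$ and $(u_n')\subseteq E$ satisfy $\|u_n'-u_n\|\le C\,d(x_n',x_n)$ and $d(x_n',x_n)\le r$ for all $n$. Conversely, suppose that conditions (1), (2) and (3) hold. Then $Sf\in\operatorname{Lip}(X,F)$ for any $f\in\operatorname{Lip}(X,E)$.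
   Context: $\operatorname{Lip}(X,E)$ is the space of all Lipschitz functions $X\to E$. A sequence $(x_n)$ in $X$ is separated if $\inf_{n\neq m}d(x_n,x_m)>0$. For $B\subseteq E$, $\Xi(x,B)=\{\Xi(x,u):u\in B\}$. *)

theory Defs
  imports "HOL-Analysis.Analysis"
begin

(* Only the values on X matter: a function X -> E is represented by any of its total extensions. *)
definition Lip :: "'a::metric_space set \<Rightarrow> ('a \<Rightarrow> 'b::metric_space) set" where
  "Lip X = {f. \<exists>L. L-lipschitz_on X f}"

(* The real-valued infimum is a true one: the family is nonempty and bounded below by 0. *)
definition separated_seq :: "(nat \<Rightarrow> 'a::metric_space) \<Rightarrow> bool" where
  "separated_seq x \<longleftrightarrow> (INF (n, m)\<in>{(n, m). n \<noteq> m}. dist (x n) (x m)) > 0"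

definition superposition :: "('a \<Rightarrow> 'b \<Rightarrow> 'c) \<Rightarrow> ('a \<Rightarrow> 'b) \<Rightarrow> 'a \<Rightarrow> 'c" where
  "superposition \<Xi> f = (\<lambda>x. \<Xi> x (f x))"

end

theory Submission
  imports Defs
begin

text \<open>
  Necessity of the three conditions is a gliding hump argument. If a condition fails, it fails
  for every candidate constant \<open>k\<close>, and this produces graph points \<open>(p\<^sub>k, a\<^sub>k)\<close> and \<open>(q\<^sub>k, b\<^sub>k)\<close>
  at which \<open>\<Xi>\<close> has difference quotient larger than \<open>k\<close> (for the first condition, single graph points
  at which \<open>\<Xi>\<close> has norm larger than \<open>k\<close>). The failure persists after
  shrinking the radius or dropping finitely many indices, so the points can be chosen one after the
  other with room between them. It remains to run one Lipschitz function \<open>f\<close> through all these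
  graph points, because then \<open>Sf\<close> cannot be Lipschitz on the bounded set \<open>X\<close>.
  Lipschitz functions with values in a Banach space need not extend from a subset with control of the constant, so \<open>f\<close> is built by
  hand: for each \<open>k\<close> a hump through the chosen points, made of radial plateau functions and with a
  Lipschitz constant independent of \<open>k\<close> (\<open>cone_hump\<close> near a point \<open>x\<^sub>0\<close>, \<open>separated_hump\<close> along a
  separated sequence). The supports are pairwise disjoint, contained in annuli around \<open>x\<^sub>0\<close>
  or in small balls around the points of the sequence, and gluing such humps at most doubles the constant
  (\<open>glue_lipschitz\<close>). For the third condition, the second one handles any finite set of indices,
  so a failure must involve infinitely many of them.

  Sufficiency rests on one dichotomy: a sequence in a complete set has a convergent subsequence
  or a separated one (\<open>convergent_or_separated_subseq\<close>). Applied to points where \<open>\<parallel>Sf\<parallel>\<close> grows without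
  bound, it shows that \<open>Sf\<close> is bounded: the second condition excludes convergence, the first one
  separation. If \<open>Sf\<close> is not Lipschitz, there are pairs \<open>p\<^sub>k, q\<^sub>k\<close> with difference quotient
  above \<open>k\<close>; boundedness of \<open>Sf\<close> gives \<open>d(p\<^sub>k, q\<^sub>k) \<rightarrow> 0\<close>. The dichotomy
  for \<open>p\<close> now contradicts the second condition (both sequences converge to the same point) or the
  third one (\<open>q\<close> is a small perturbation of a separated sequence).
\<close>

section \<open>The three conditions\<close>

definition bounded_off_finite ::
    "'a::metric_space set \<Rightarrow> ('a \<Rightarrow> 'b::banach \<Rightarrow> 'c::banach) \<Rightarrow> bool" where
  "bounded_off_finite X \<Xi> \<longleftrightarrow>
    (\<forall>x B. range x \<subseteq> X \<and> separated_seq x \<and> bounded B \<longrightarrow>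
       (\<exists>N. finite N \<and> bounded (\<Union>n\<in>-N. \<Xi> (x n) ` B)))"

definition lipschitz_on_cones ::
    "'a::metric_space set \<Rightarrow> ('a \<Rightarrow> 'b::banach \<Rightarrow> 'c::banach) \<Rightarrow> bool" where
  "lipschitz_on_cones X \<Xi> \<longleftrightarrow>
    (\<forall>x0\<in>X. \<forall>u0. \<forall>C::real. \<exists>r>0. \<exists>D::real.
       \<forall>x1\<in>X. \<forall>x2\<in>X. \<forall>u1 u2.
         norm (u1 - u2) \<le> C * dist x1 x2 \<and>
         norm (u1 - u0) \<le> C * dist x1 x0 \<and> norm (u2 - u0) \<le> C * dist x2 x0 \<and>
         dist x1 x0 \<le> r \<and> dist x2 x0 \<le> r \<longrightarrow>
         norm (\<Xi> x1 u1 - \<Xi> x2 u2) \<le> D * dist x1 x2)"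

definition uniform_at_separated ::
    "'a::metric_space set \<Rightarrow> ('a \<Rightarrow> 'b::banach \<Rightarrow> 'c::banach) \<Rightarrow> bool" where
  "uniform_at_separated X \<Xi> \<longleftrightarrow>
    (\<forall>x u. range x \<subseteq> X \<and> separated_seq x \<and> bounded (range u) \<longrightarrow>
       (\<forall>C::real. \<exists>r>0. \<exists>D::real. \<forall>x' u'.
         range x' \<subseteq> X \<and>
         (\<forall>n. norm (u' n - u n) \<le> C * dist (x' n) (x n) \<and> dist (x' n) (x n) \<le> r) \<longrightarrow>
         (\<forall>n. norm (\<Xi> (x' n) (u' n) - \<Xi> (x n) (u n)) \<le> D * dist (x' n) (x n))))"

lemma lipschitz_on_conesE:
  assumes "lipschitz_on_cones X \<Xi>" and "x0 \<in> X"
  obtains r D where "r > 0"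
    "\<And>x1 x2 u1 u2. x1 \<in> X \<Longrightarrow> x2 \<in> X \<Longrightarrow> norm (u1 - u2) \<le> C * dist x1 x2 \<Longrightarrow>
      norm (u1 - u0) \<le> C * dist x1 x0 \<Longrightarrow> norm (u2 - u0) \<le> C * dist x2 x0 \<Longrightarrow>
      dist x1 x0 \<le> r \<Longrightarrow> dist x2 x0 \<le> r \<Longrightarrow> norm (\<Xi> x1 u1 - \<Xi> x2 u2) \<le> D * dist x1 x2"
  using assms unfolding lipschitz_on_cones_def by meson

section \<open>Separated sequences and Lipschitz functions\<close>

lemma separated_seq_iff:
  "separated_seq x \<longleftrightarrow> (\<exists>\<delta>>0. \<forall>n m. n \<noteq> m \<longrightarrow> \<delta> \<le> dist (x n) (x m))"
proof -
  let ?P = "{(n::nat, m). n \<noteq> m}"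
  let ?d = "\<lambda>(n, m). dist (x n) (x m)"
  have "(0, 1) \<in> ?P" by simp
  then have ne: "?P \<noteq> {}" by blast
  have bdd: "bdd_below (?d ` ?P)" by (rule bdd_belowI2[of _ 0]) auto
  show ?thesis unfolding separated_seq_def
  proof
    assume "0 < (INF nm\<in>?P. ?d nm)"
    moreover have "(INF nm\<in>?P. ?d nm) \<le> dist (x n) (x m)" if "n \<noteq> m" for n m
      using cINF_lower[OF bdd, of "(n, m)"] that by simp
    ultimately show "\<exists>\<delta>>0. \<forall>n m. n \<noteq> m \<longrightarrow> \<delta> \<le> dist (x n) (x m)" by blast
  next
    assume "\<exists>\<delta>>0. \<forall>n m. n \<noteq> m \<longrightarrow> \<delta> \<le> dist (x n) (x m)"
    then obtain \<delta> where "\<delta> > 0" "\<And>n m. n \<noteq> m \<Longrightarrow> \<delta> \<le> dist (x n) (x m)" by blast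
    moreover have "\<delta> \<le> (INF nm\<in>?P. ?d nm)"
      by (rule cINF_greatest[OF ne]) (use calculation in auto)
    ultimately show "0 < (INF nm\<in>?P. ?d nm)" by linarith
  qed
qed

lemma Lip_image_bounded:
  assumes "f \<in> Lip X" and "bounded X"
  shows "bounded (f ` X)"
proof -
  obtain L where L: "L-lipschitz_on X f" using assms(1) by (auto simp: Lip_def)
  have L0: "L \<ge> 0" by (rule lipschitz_on_nonneg[OF L])
  obtain e where e: "\<And>x y. x \<in> X \<Longrightarrow> y \<in> X \<Longrightarrow> dist x y \<le> e"
    using assms(2) by (auto simp: bounded_two_points)
  have "dist (f x) (f y) \<le> L * e" if "x \<in> X" "y \<in> X" for x y
    using lipschitz_onD[OF L that] mult_left_mono[OF e[OF that] L0] by linarith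
  then show ?thesis by (auto simp: bounded_two_points)
qed

text \<open>
  If the range of the sequence is totally bounded, its closure is compact and the subsequence
  converges. Otherwise some \<open>e > 0\<close> has the property that no finite part of the range is
  an \<open>e\<close>-net for it; choosing each next term at distance \<open>e\<close> from the whole initial
  segment up to the last chosen index gives a separated subsequence.
\<close>
lemma convergent_or_separated_subseq:
  fixes x :: "nat \<Rightarrow> 'a::metric_space"
  assumes "complete X" and "range x \<subseteq> X"
  obtains (convergent) s l where "strict_mono s" "l \<in> X" "(x \<circ> s) \<longlonglongrightarrow> l"
    | (separated) s where "strict_mono s" "separated_seq (x \<circ> s)"
proof (cases "\<exists>e>0. \<forall>m. \<exists>n. \<forall>i\<le>m. e \<le> dist (x n) (x i)")
  case True
  then obtain e g where e: "e > 0" and g: "\<And>m i. i \<le> m \<Longrightarrow> e \<le> dist (x (g m)) (x i)"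
    by metis
  define s where "s k = (g ^^ k) 0" for k
  have sSuc: "s (Suc k) = g (s k)" for k by (simp add: s_def)
  \<comment> \<open>The term with index \<open>g m\<close> is far from all terms up to \<open>m\<close>, so it cannot be one of them.\<close>
  have g_gt: "g m > m" for m
  proof (rule ccontr)
    assume "\<not> m < g m"
    then have "e \<le> dist (x (g m)) (x (g m))" by (intro g) simp
    with e show False by simp
  qed
  have s: "strict_mono s" by (simp add: strict_mono_Suc_iff sSuc g_gt)
  have later: "e \<le> dist (x (s k)) (x (s j))" if "j < k" for j k
  proof -
    obtain k' where k': "k = Suc k'" using \<open>j < k\<close> by (rule lessE)
    have "s j \<le> s k'" using s that k' by (simp add: strict_mono_less_eq)
    then show ?thesis unfolding k' sSuc by (rule g)
  qed
  then have "e \<le> dist (x (s n)) (x (s m))" if "n \<noteq> m" for n m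
    using that by (metis dist_commute nat_neq_iff)
  then have "separated_seq (x \<circ> s)" using e by (auto simp: separated_seq_iff)
  with s show thesis by (rule separated)
next
  case False
  then have tb: "\<exists>m. \<forall>n. \<exists>i\<le>m. dist (x n) (x i) < e" if "e > 0" for e
    using that by (meson not_le)
  let ?K = "closure (range x)"
  have sub: "?K \<subseteq> X" using assms complete_imp_closed closure_minimal by blast
  have "complete (X \<inter> ?K)" using assms(1) by (intro complete_Int_closed) auto
  then have "complete ?K" using sub by (simp add: Int_absorb1)
  moreover have "\<exists>k. finite k \<and> ?K \<subseteq> (\<Union>c\<in>k. ball c e)" if "e > 0" for e
  proof -
    obtain m where m: "\<And>n. \<exists>i\<le>m. dist (x n) (x i) < e / 2" using tb[of "e / 2"] \<open>e > 0\<close> by (meson half_gt_zero)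
    have "y \<in> (\<Union>c\<in>x ` {..m}. ball c e)" if "y \<in> ?K" for y
    proof -
      obtain n where n: "dist (x n) y < e / 2"
        using \<open>y \<in> ?K\<close> \<open>e > 0\<close> closure_approachable[of y "range x"]
        by (metis half_gt_zero rangeE)
      obtain i where "i \<le> m" "dist (x n) (x i) < e / 2" using m by blast
      then show ?thesis using n dist_triangle_half_r[of "x n" "x i" e y]
        by (auto simp: dist_commute)
    qed
    then show ?thesis by (intro exI[of _ "x ` {..m}"]) auto
  qed
  ultimately have "compact ?K" by (simp add: compact_eq_totally_bounded)
  moreover have "\<forall>n. x n \<in> ?K" by (simp add: closure_subset[THEN subsetD])
  ultimately obtain l s where "l \<in> ?K" "strict_mono s" "(x \<circ> s) \<longlonglongrightarrow> l"
    unfolding compact_def by blast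
  then show thesis using sub convergent by blast
qed

section \<open>Lipschitz humps and gluing\<close>

text \<open>
  The trapezoidal bump: \<open>1\<close> on \<open>[s, t]\<close>, then falling to \<open>0\<close> with slope \<open>1 / \<rho>\<close>. Composed with the
  distance to a centre it cuts off to an annulus, to a ball (\<open>s = 0\<close>), or gives a spike at the
  centre (\<open>s = t = 0\<close>).
\<close>
definition plateau :: "real \<Rightarrow> real \<Rightarrow> real \<Rightarrow> real \<Rightarrow> real" where
  "plateau s t \<rho> v = max 0 (1 - max 0 (max (s - v) (v - t)) / \<rho>)"

lemma plateau_eq_1: "s \<le> v \<Longrightarrow> v \<le> t \<Longrightarrow> plateau s t \<rho> v = 1"
  by (simp add: plateau_def)

lemma plateau_eq_0: "\<rho> > 0 \<Longrightarrow> v \<le> s - \<rho> \<or> t + \<rho> \<le> v \<Longrightarrow> plateau s t \<rho> v = 0"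
  by (auto simp: plateau_def max_def field_simps)

lemma plateau_lipschitz:
  assumes "\<rho> > 0"
  shows "\<bar>plateau s t \<rho> v - plateau s t \<rho> w\<bar> \<le> \<bar>v - w\<bar> / \<rho>"
proof -
  let ?m = "\<lambda>v. max 0 (max (s - v) (v - t))"
  have "\<bar>plateau s t \<rho> v - plateau s t \<rho> w\<bar> \<le> \<bar>?m v / \<rho> - ?m w / \<rho>\<bar>"
    unfolding plateau_def by (smt (verit))
  also have "\<dots> = \<bar>?m v - ?m w\<bar> / \<rho>"
    using assms by (metis abs_divide abs_of_pos diff_divide_distrib)
  also have "\<dots> \<le> \<bar>v - w\<bar> / \<rho>" using assms by (intro divide_right_mono) (auto simp: max_def)
  finally show ?thesis .
qed

text \<open>
  The constant depends only on the ratio of height and slope width. This makes humps around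
  points of arbitrarily small mutual distance uniformly Lipschitz, as long as their heights
  shrink in proportion.
\<close>
lemma hump_lipschitz:
  fixes a :: "'b::real_normed_vector"
  assumes "\<rho> > 0" and a: "norm a \<le> K * \<rho>"
  shows "K-lipschitz_on X (\<lambda>x. plateau s t \<rho> (dist x c) *\<^sub>R a)"
proof (rule lipschitz_onI)
  have "0 \<le> K * \<rho>" using a norm_ge_zero order_trans by blast
  then show K: "0 \<le> K" using assms(1) by (simp add: zero_le_mult_iff)
  fix x y
  have "dist (plateau s t \<rho> (dist x c) *\<^sub>R a) (plateau s t \<rho> (dist y c) *\<^sub>R a)
      = \<bar>plateau s t \<rho> (dist x c) - plateau s t \<rho> (dist y c)\<bar> * norm a"
    by (simp add: dist_norm flip: scaleR_left_diff_distrib)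
  also have "\<dots> \<le> (\<bar>dist x c - dist y c\<bar> / \<rho>) * (K * \<rho>)"
    using plateau_lipschitz[OF assms(1)] a assms(1) by (intro mult_mono) auto
  also have "\<dots> = K * \<bar>dist x c - dist y c\<bar>" using assms(1) by simp
  also have "\<dots> \<le> K * dist x y"
    using K abs_dist_diff_le[of x c y] by (intro mult_left_mono) (auto simp: dist_commute)
  finally show "dist (plateau s t \<rho> (dist x c) *\<^sub>R a) (plateau s t \<rho> (dist y c) *\<^sub>R a) \<le> K * dist x y" .
qed

text \<open>
  At most one of the functions is nonzero at a given point, so their sum takes there the value of
  that function. Between two points only the two functions active there contribute to the
  difference, hence the factor \<open>2\<close>, however many functions are glued.
\<close>
lemma glue_lipschitz:
  fixes f :: "'i \<Rightarrow> 'a::metric_space \<Rightarrow> 'b::real_normed_vector"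
  assumes lip: "\<And>k. K-lipschitz_on X (f k)"
    and disj: "\<And>j k x. j \<noteq> k \<Longrightarrow> f j x = 0 \<or> f k x = 0"
  obtains g where "(2 * K)-lipschitz_on X g" "\<And>k x. (\<And>j. j \<noteq> k \<Longrightarrow> f j x = 0) \<Longrightarrow> g x = f k x"
proof
  \<comment> \<open>Where all functions vanish, every choice of the index gives the right value \<open>0\<close>.\<close>
  define i where "i x = (SOME k. f k x \<noteq> 0)" for x
  have i: "i x = k" if "f k x \<noteq> 0" for k x
  proof -
    have "f (i x) x \<noteq> 0" unfolding i_def by (rule someI[of _ k]) (rule that)
    with that disj show ?thesis by blast
  qed
  show "f (i x) x = f k x" if "\<And>j. j \<noteq> k \<Longrightarrow> f j x = 0" for k x
    using i that by metis
  have K: "0 \<le> K" using lip lipschitz_on_nonneg by blast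
  show "(2 * K)-lipschitz_on X (\<lambda>x. f (i x) x)"
  proof (rule lipschitz_onI)
    fix x y assume xy: "x \<in> X" "y \<in> X"
    let ?n = "i x" and ?m = "i y"
    have n: "norm (f ?n x - f ?n y) \<le> K * dist x y"
      and m: "norm (f ?m x - f ?m y) \<le> K * dist x y"
      using lipschitz_onD[OF lip xy] by (auto simp: dist_norm)
    have "norm (f ?n x - f ?m y) \<le> 2 * (K * dist x y)"
    proof (cases "?n = ?m")
      case True
      with n K show ?thesis by (smt (verit) mult_nonneg_nonneg zero_le_dist)
    next
      case False
      then have "f ?n y = 0" "f ?m x = 0" using i by metis+
      then have "f ?n x - f ?m y = (f ?n x - f ?n y) + (f ?m x - f ?m y)" by simp
      then show ?thesis using norm_triangle_ineq[of "f ?n x - f ?n y" "f ?m x - f ?m y"] n m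
        by simp
    qed
    then show "dist (f ?n x) (f ?m y) \<le> 2 * K * dist x y" by (simp add: dist_norm)
  qed (use K in simp)
qed

text \<open>
  The common end of the gliding hump arguments: the glued function passes through all the prescribed
  graph points, so a single Lipschitz constant of its superposition serves every \<open>k\<close>, and some
  \<open>k\<close> exceeds this constant. The shift \<open>u\<close> allows humps over a constant function other than zero.
\<close>
lemma superposition_glued_lipschitz:
  fixes \<Xi> :: "'a::metric_space \<Rightarrow> 'b::real_normed_vector \<Rightarrow> 'c::real_normed_vector"
  assumes S: "\<forall>f\<in>Lip X. superposition \<Xi> f \<in> Lip X"
    and lip: "\<And>k::nat. K-lipschitz_on X (f k)"
    and disj: "\<And>j k x. j \<noteq> k \<Longrightarrow> f j x = 0 \<or> f k x = 0"
    and pq: "\<And>k. p k \<in> X" "\<And>k. q k \<in> X"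
    and off: "\<And>j k. j \<noteq> k \<Longrightarrow> f j (p k) = 0" "\<And>j k. j \<noteq> k \<Longrightarrow> f j (q k) = 0"
  shows "\<exists>k. norm (\<Xi> (p k) (u + f k (p k)) - \<Xi> (q k) (u + f k (q k))) \<le> real k * dist (p k) (q k)"
proof -
  obtain g where g: "(2 * K)-lipschitz_on X g" and gf: "\<And>k x. (\<And>j. j \<noteq> k \<Longrightarrow> f j x = 0) \<Longrightarrow> g x = f k x"
    using lip disj by (rule glue_lipschitz[where f = f]) blast+
  have "(0 + 2 * K)-lipschitz_on X (\<lambda>x. u + g x)"
    by (intro lipschitz_on_add lipschitz_on_constant g)
  then have "superposition \<Xi> (\<lambda>x. u + g x) \<in> Lip X" using S by (auto simp: Lip_def)
  then obtain L where L: "L-lipschitz_on X (superposition \<Xi> (\<lambda>x. u + g x))" by (auto simp: Lip_def)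
  obtain k where k: "L \<le> real k" using real_arch_simple by blast
  have "norm (\<Xi> (p k) (u + f k (p k)) - \<Xi> (q k) (u + f k (q k))) \<le> L * dist (p k) (q k)"
    using lipschitz_onD[OF L pq, of k k] gf[of k "p k"] gf[of k "q k"] off
    by (simp add: superposition_def dist_norm)
  also have "\<dots> \<le> real k * dist (p k) (q k)" using k by (intro mult_right_mono) auto
  finally show ?thesis by blast
qed

text \<open>
  Two graph points in a cone with apex \<open>(c, 0)\<close> are joined by a hump that vanishes near the apex.
  The value \<open>b\<close> of the point \<open>q\<close> nearer to the apex is spread over an annulus that contains both points,
  and the correction \<open>a - b\<close> is added near \<open>p\<close>. Starting from the nearer point is
  essential: the slope at the inner edge of the annulus is the value divided by the inner radius,
  and \<open>a\<close> may be much larger than this radius. The point \<open>q\<close> may be the apex itself; then \<open>b = 0\<close>,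
  and the inner radius \<open>\<sigma>\<close> is that of \<open>p\<close>.
\<close>
lemma cone_hump:
  fixes a b :: "'b::real_normed_vector"
  assumes "p \<noteq> q" and near: "dist q c \<le> dist p c"
    and ab: "norm (a - b) \<le> C * dist p q" "norm a \<le> C * dist p c" "norm b \<le> C * dist q c"
  defines "\<sigma> \<equiv> if q = c then dist p c else dist q c"
  obtains f where "(6 * C)-lipschitz_on X f" "f p = a" "f q = b"
    "\<And>x. f x \<noteq> 0 \<Longrightarrow> \<sigma> / 2 < dist x c \<and> dist x c < 3 / 2 * dist p c"
proof -
  let ?t = "dist p c"
  \<comment> \<open>The correction must not reach \<open>q\<close>, and must stay away from the apex.\<close>
  define \<rho> where "\<rho> = min (dist p q) (?t / 2)"
  have t: "?t > 0" using assms(1) near by (smt (verit) zero_less_dist_iff dist_commute dist_eq_0_iff)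
  have \<sigma>: "\<sigma> > 0" "\<sigma> \<le> ?t" using t near by (auto simp: \<sigma>_def)
  have \<rho>: "\<rho> > 0" "\<rho> \<le> dist p q" "\<rho> \<le> ?t / 2" using t assms(1) by (auto simp: \<rho>_def)
  have C: "C \<ge> 0" using ab(2) t by (smt (verit) norm_ge_zero zero_le_mult_iff)
  have b: "norm b \<le> C * \<sigma>" using ab(3) by (auto simp: \<sigma>_def C)
  have "norm (a - b) \<le> 2 * C * ?t"
    using norm_triangle_ineq4[of a b] ab(2,3) mult_left_mono[OF near C] by simp
  moreover have "C * dist p q \<le> 4 * C * dist p q"
    using C by (intro mult_right_mono) auto
  ultimately have d: "norm (a - b) \<le> 4 * C * \<rho>" using ab(1) by (auto simp: \<rho>_def min_def)
  define f where "f x = plateau \<sigma> ?t (\<sigma> / 2) (dist x c) *\<^sub>R b + plateau 0 0 \<rho> (dist x p) *\<^sub>R (a - b)" for x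
  show thesis
  proof
    have "(2 * C + 4 * C)-lipschitz_on X f" unfolding f_def
      by (intro lipschitz_on_add hump_lipschitz) (use \<sigma> \<rho> b d in auto)
    then show "(6 * C)-lipschitz_on X f" by simp
    show "f p = a" using \<sigma> by (simp add: f_def plateau_eq_1)
    have "plateau \<sigma> ?t (\<sigma> / 2) (dist q c) *\<^sub>R b = b"
    proof (cases "q = c")
      case True
      then have "b = 0" using ab(3) by simp
      then show ?thesis by simp
    next
      case False
      then show ?thesis using near by (simp add: \<sigma>_def plateau_eq_1)
    qed
    moreover have "plateau 0 0 \<rho> (dist q p) = 0"
      by (rule plateau_eq_0) (use \<rho> in \<open>auto simp: dist_commute\<close>)
    ultimately show "f q = b" by (simp add: f_def)
    fix x assume "f x \<noteq> 0"
    then have "plateau \<sigma> ?t (\<sigma> / 2) (dist x c) \<noteq> 0 \<or> plateau 0 0 \<rho> (dist x p) \<noteq> 0"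
      by (auto simp: f_def)
    then show "\<sigma> / 2 < dist x c \<and> dist x c < 3 / 2 * ?t"
    proof (elim disjE, goal_cases)
      case 1
      then have "\<not> (dist x c \<le> \<sigma> - \<sigma> / 2 \<or> ?t + \<sigma> / 2 \<le> dist x c)"
        using plateau_eq_0[of "\<sigma> / 2"] \<sigma> by auto
      then show ?thesis using \<sigma> by auto
    next
      case 2
      then have "dist x p < \<rho>" using plateau_eq_0[of \<rho> "dist x p" 0 0] \<rho> by force
      then show ?thesis using \<rho> \<sigma> dist_triangle[of x c p] dist_triangle3[of p c x] by auto
    qed
  qed
qed

text \<open>
  The value \<open>u\<close> is spread over the ball of radius \<open>r\<close> around \<open>c\<close>, which contains \<open>x'\<close>, and
  \<open>u' - u\<close> is added near \<open>x'\<close> without reaching \<open>c\<close>. Only the correction has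
  to be steep at the scale of the distance of \<open>x'\<close> and \<open>c\<close>, and it is small in proportion.
\<close>
lemma separated_hump:
  fixes u u' :: "'b::real_normed_vector"
  assumes "r > 0" and "x' \<noteq> c" and "dist x' c \<le> r"
    and u: "norm u \<le> M" and u': "norm (u' - u) \<le> C * dist x' c"
  obtains f where "(M / r + C)-lipschitz_on X f" "f c = u" "f x' = u'"
    "\<And>x. f x \<noteq> 0 \<Longrightarrow> dist x c < 2 * r"
proof -
  let ?d = "dist x' c"
  have d: "?d > 0" using assms by simp
  define f where "f x = plateau 0 r r (dist x c) *\<^sub>R u + plateau 0 0 ?d (dist x x') *\<^sub>R (u' - u)" for x
  show thesis
  proof
    have "norm u \<le> M / r * r" using u \<open>r > 0\<close> by simp
    then show "(M / r + C)-lipschitz_on X f" unfolding f_def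
      by (intro lipschitz_on_add hump_lipschitz \<open>r > 0\<close> d u')
    have "plateau 0 0 ?d (dist c x') = 0"
      by (rule plateau_eq_0) (use d in \<open>auto simp: dist_commute\<close>)
    then show "f c = u" using assms(1) by (simp add: f_def plateau_eq_1)
    show "f x' = u'" using assms by (simp add: f_def plateau_eq_1)
    fix x assume "f x \<noteq> 0"
    then have "plateau 0 r r (dist x c) \<noteq> 0 \<or> plateau 0 0 ?d (dist x x') \<noteq> 0"
      by (auto simp: f_def)
    then show "dist x c < 2 * r"
    proof (elim disjE, goal_cases)
      case 1
      then show ?thesis using plateau_eq_0[of r "dist x c" 0 r] assms(1) by force
    next
      case 2
      then have "dist x x' < ?d" using plateau_eq_0[of ?d "dist x x'" 0 0] d by force
      then show ?thesis using assms(3) dist_triangle[of x c x'] by linarith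
    qed
  qed
qed

section \<open>Necessity of the three conditions\<close>

text \<open>Picks indices with increasing demands \<open>k\<close> in increasing order, in particular without repetition.\<close>
lemma strict_mono_choice:
  assumes "\<And>k m. \<exists>n>m. P k (n::nat)"
  obtains s where "strict_mono s" "\<And>k::nat. P k (s k)"
proof -
  have "\<exists>s. \<forall>k. P k (s k) \<and> s k < s (Suc k)"
    by (rule dependent_nat_choice) (use assms in blast)+
  then show thesis using that by (auto simp: strict_mono_Suc_iff)
qed

text \<open>
  Values \<open>b\<^sub>k \<in> B\<close> at distinct terms \<open>x (s k)\<close> on which \<open>\<Xi>\<close> is larger than \<open>k\<close> are interpolated by
  one Lipschitz function \<open>g\<close>: the terms are separated and \<open>B\<close> is bounded, so humps of a fixed
  width will do. Its superposition is Lipschitz on a bounded set and thus bounded, a contradiction.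
\<close>
lemma bounded_off_finite_necessary:
  fixes \<Xi> :: "'a::metric_space \<Rightarrow> 'b::banach \<Rightarrow> 'c::banach"
  assumes "bounded X" and S: "\<forall>f\<in>Lip X. superposition \<Xi> f \<in> Lip X"
  shows "bounded_off_finite X \<Xi>"
  unfolding bounded_off_finite_def
proof (intro allI impI, elim conjE, rule ccontr)
  fix x :: "nat \<Rightarrow> 'a" and B :: "'b set"
  assume x: "range x \<subseteq> X" "separated_seq x" and B: "bounded B"
    and no: "\<not> (\<exists>N. finite N \<and> bounded (\<Union>n\<in>-N. \<Xi> (x n) ` B))"
  have "\<exists>n>m. \<exists>b\<in>B. norm (\<Xi> (x n) b) > real k" for k m
  proof -
    have "\<not> bounded (\<Union>n\<in>-{..m}. \<Xi> (x n) ` B)" using no by blast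
    then have "\<exists>y\<in>(\<Union>n\<in>-{..m}. \<Xi> (x n) ` B). norm y > real k"
      unfolding bounded_iff by (meson not_le)
    then show ?thesis by (auto simp: not_le)
  qed
  then obtain s where s: "strict_mono s" and "\<And>k. \<exists>b\<in>B. norm (\<Xi> (x (s k)) b) > real k"
    using strict_mono_choice[of "\<lambda>k n. \<exists>b\<in>B. norm (\<Xi> (x n) b) > real k"] by blast
  then obtain b where b: "\<And>k. b k \<in> B" and big: "\<And>k. norm (\<Xi> (x (s k)) (b k)) > real k" by metis
  obtain \<delta> where \<delta>: "\<delta> > 0" "\<And>n m. n \<noteq> m \<Longrightarrow> \<delta> \<le> dist (x n) (x m)"
    using x(2) by (auto simp: separated_seq_iff)
  have sep: "\<delta> \<le> dist (x (s j)) (x (s k))" if "j \<noteq> k" for j k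
    using \<delta>(2) s that by (simp add: strict_mono_eq)
  obtain M where M: "\<And>v. v \<in> B \<Longrightarrow> norm v \<le> M" using B by (auto simp: bounded_iff)
  define f where "f k y = plateau 0 0 (\<delta> / 2) (dist y (x (s k))) *\<^sub>R b k" for k y
  have supp: "dist y (x (s k)) < \<delta> / 2" if "f k y \<noteq> 0" for k y
    using that plateau_eq_0[of "\<delta> / 2" "dist y (x (s k))" 0 0] \<delta>(1) by (force simp: f_def)
  have lip: "(M / (\<delta> / 2))-lipschitz_on X (f k)" for k
    unfolding f_def by (rule hump_lipschitz) (use \<delta> M[OF b] in auto)
  have disj: "f j y = 0 \<or> f k y = 0" if "j \<noteq> k" for j k y
    using supp[of j y] supp[of k y] sep[OF that] dist_triangle3[of "x (s j)" "x (s k)" y] by force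
  obtain g where g: "(2 * (M / (\<delta> / 2)))-lipschitz_on X g"
    and gf: "\<And>k y. (\<And>j. j \<noteq> k \<Longrightarrow> f j y = 0) \<Longrightarrow> g y = f k y"
    using lip disj by (rule glue_lipschitz[where f = f]) blast+
  have "g (x (s k)) = b k" for k
  proof -
    have "f j (x (s k)) = 0" if "j \<noteq> k" for j
      using supp[of j "x (s k)"] sep[OF that] \<delta>(1) by (force simp: dist_commute)
    then have "g (x (s k)) = f k (x (s k))" by (rule gf)
    then show ?thesis by (simp add: f_def plateau_eq_1)
  qed
  moreover have "superposition \<Xi> g \<in> Lip X" using S g by (auto simp: Lip_def)
  then have "bounded (superposition \<Xi> g ` X)" using assms(1) by (rule Lip_image_bounded)
  then obtain R where "\<And>y. y \<in> X \<Longrightarrow> norm (\<Xi> y (g y)) \<le> R"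
    by (auto simp: bounded_iff superposition_def)
  ultimately have "norm (\<Xi> (x (s k)) (b k)) \<le> R" for k using x(1) by (metis range_subsetD)
  moreover obtain k where "R \<le> real k" using real_arch_simple by blast
  ultimately show False using big[of k] by (smt (verit))
qed

text \<open>
  A bad pair with difference quotient above \<open>k\<close> exists within every radius of \<open>x0\<close>. Each pair is chosen
  so close to \<open>x0\<close> that its hump lies inside the annulus used by the previous one.
\<close>
lemma lipschitz_on_cones_necessary:
  fixes \<Xi> :: "'a::metric_space \<Rightarrow> 'b::banach \<Rightarrow> 'c::banach"
  assumes S: "\<forall>f\<in>Lip X. superposition \<Xi> f \<in> Lip X"
  shows "lipschitz_on_cones X \<Xi>"
  unfolding lipschitz_on_cones_def
proof (intro ballI allI, rule ccontr)
  fix x0 u0 and C :: real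
  assume "x0 \<in> X"
  define bad where "bad D p q a b \<longleftrightarrow> p \<in> X \<and> q \<in> X \<and> norm (a - b) \<le> C * dist p q \<and>
      norm (a - u0) \<le> C * dist p x0 \<and> norm (b - u0) \<le> C * dist q x0 \<and>
      norm (\<Xi> p a - \<Xi> q b) > D * dist p q" for D p q a b
  assume no: "\<not> (\<exists>r>0. \<exists>D. \<forall>x1\<in>X. \<forall>x2\<in>X. \<forall>u1 u2.
         norm (u1 - u2) \<le> C * dist x1 x2 \<and>
         norm (u1 - u0) \<le> C * dist x1 x0 \<and> norm (u2 - u0) \<le> C * dist x2 x0 \<and>
         dist x1 x0 \<le> r \<and> dist x2 x0 \<le> r \<longrightarrow>
         norm (\<Xi> x1 u1 - \<Xi> x2 u2) \<le> D * dist x1 x2)"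
  have bad_sym: "bad D p q a b \<Longrightarrow> bad D q p b a" for D p q a b
    by (simp add: bad_def dist_commute norm_minus_commute)
  have bad_ne: "p \<noteq> q" if "bad D p q a b" for D p q a b
    using that by (auto simp: bad_def)
  have ex: "\<exists>p q a b. bad D p q a b \<and> dist q x0 \<le> dist p x0 \<and> dist p x0 \<le> r"
    if "r > 0" for r D
  proof -
    have "\<exists>p q a b. bad D p q a b \<and> dist p x0 \<le> r \<and> dist q x0 \<le> r"
      using no that unfolding bad_def by (meson not_le)
    then obtain p q a b where "bad D p q a b" "dist p x0 \<le> r" "dist q x0 \<le> r" by blast
    then show ?thesis using bad_sym by (cases "dist q x0 \<le> dist p x0") (blast, force)
  qed
  define \<sigma> where "\<sigma> p q = (if q = x0 then dist p x0 else dist q x0)" for p q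
  have \<sigma>_pos: "\<sigma> p q > 0" if "p \<noteq> q" for p q using that by (auto simp: \<sigma>_def)
  have \<sigma>_le: "\<sigma> p q \<le> dist p x0" if "dist q x0 \<le> dist p x0" for p q
    using that by (auto simp: \<sigma>_def)
  \<comment> \<open>The hump of a pair lives at distances between \<open>\<sigma> p q / 2\<close> and \<open>3 / 2 * dist p x0\<close> from \<open>x0\<close>; the
    factor \<open>1 / 3\<close> puts the outer radius of the next hump at or below the inner radius of this one.\<close>
  let ?P = "\<lambda>k (p, q, a, b). bad (real k) p q a b \<and> dist q x0 \<le> dist p x0"
  let ?Q = "\<lambda>(k::nat) (p, q, a, b) (p', q', a', b'). dist p' x0 \<le> \<sigma> p q / 3"
  have "\<exists>z. \<forall>k. ?P k (z k) \<and> ?Q k (z k) (z (Suc k))"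
  proof (rule dependent_nat_choice)
    show "\<exists>z. ?P 0 z" using ex[of 1 0] by auto
    fix z k assume "?P k z"
    then show "\<exists>z'. ?P (Suc k) z' \<and> ?Q k z z'"
      using ex[of "\<sigma> (fst z) (fst (snd z)) / 3" "real (Suc k)"] bad_ne \<sigma>_pos
      by (fastforce split: prod.splits)
  qed
  then obtain z where z: "\<forall>k. ?P k (z k) \<and> ?Q k (z k) (z (Suc k))" ..
  define p q a b where defs: "p k = fst (z k)" "q k = fst (snd (z k))"
    "a k = fst (snd (snd (z k)))" "b k = snd (snd (snd (z k)))" for k
  have bad: "bad (real k) (p k) (q k) (a k) (b k)" and near: "dist (q k) x0 \<le> dist (p k) x0"
    and step: "dist (p (Suc k)) x0 \<le> \<sigma> (p k) (q k) / 3" for k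
    using spec[OF z, of k] by (simp_all add: defs split_beta)
  have pq: "p k \<in> X" "q k \<in> X" "p k \<noteq> q k" for k
    using bad[of k] by (auto simp: bad_def)
  have "antimono (\<lambda>k. dist (p k) x0)"
  proof (rule decseq_SucI)
    show "dist (p (Suc k)) x0 \<le> dist (p k) x0" for k
      using step[of k] \<sigma>_le[OF near[of k]] \<sigma>_pos[OF pq(3)[of k]] by linarith
  qed
  then have shrink: "dist (p k) x0 \<le> \<sigma> (p j) (q j) / 3" if "j < k" for j k
    using antimonoD[of "\<lambda>k. dist (p k) x0" "Suc j" k] step[of j] that by (auto simp: Suc_le_eq)
  have "\<exists>f. (6 * C)-lipschitz_on X f \<and> f (p k) = a k - u0 \<and> f (q k) = b k - u0 \<and>
      (\<forall>x. f x \<noteq> 0 \<longrightarrow> \<sigma> (p k) (q k) / 2 < dist x x0 \<and> dist x x0 < 3 / 2 * dist (p k) x0)" for k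
  proof -
    have "norm ((a k - u0) - (b k - u0)) \<le> C * dist (p k) (q k)"
      "norm (a k - u0) \<le> C * dist (p k) x0" "norm (b k - u0) \<le> C * dist (q k) x0"
      using bad[of k] by (simp_all add: bad_def)
    from cone_hump[OF pq(3) near this, where X = X] show ?thesis
      unfolding \<sigma>_def by blast
  qed
  then obtain f where lip: "\<And>k. (6 * C)-lipschitz_on X (f k)"
    and fp: "\<And>k. f k (p k) = a k - u0" and fq: "\<And>k. f k (q k) = b k - u0"
    and supp: "\<And>k x. f k x \<noteq> 0 \<Longrightarrow> \<sigma> (p k) (q k) / 2 < dist x x0 \<and> dist x x0 < 3 / 2 * dist (p k) x0"
    by metis
  have disj: "f j x = 0 \<or> f k x = 0" if "j \<noteq> k" for j k x
  proof -
    have "f i x = 0 \<or> f l x = 0" if "i < l" for i l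
      using supp[of i x] supp[of l x] shrink[OF that] by force
    then show ?thesis using that by (metis nat_neq_iff)
  qed
  have off_p: "f j (p k) = 0" if "j \<noteq> k" for j k
  proof (rule ccontr)
    assume "f j (p k) \<noteq> 0"
    note s = supp[OF this]
    show False
    proof (cases "j < k")
      case True
      then show ?thesis using s shrink[of j k] \<sigma>_pos[OF pq(3)[of j]] by linarith
    next
      case False
      then have "k < j" using that by simp
      then show ?thesis using s shrink[of k j] \<sigma>_le[OF near[of k]] \<sigma>_pos[OF pq(3)[of k]] by linarith
    qed
  qed
  have off_q: "f j (q k) = 0" if "j \<noteq> k" for j k
  proof (rule ccontr)
    assume "f j (q k) \<noteq> 0"
    note s = supp[OF this]
    \<comment> \<open>Unlike \<open>p k\<close>, the point \<open>q k\<close> may be \<open>x0\<close>, where all humps vanish.\<close>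
    have "q k \<noteq> x0" using s \<sigma>_pos[OF pq(3)[of j]] by auto
    then have q: "dist (q k) x0 = \<sigma> (p k) (q k)" by (simp add: \<sigma>_def)
    show False
    proof (cases "j < k")
      case True
      then show ?thesis using s shrink[of j k] near[of k] \<sigma>_pos[OF pq(3)[of j]] by linarith
    next
      case False
      then have "k < j" using that by simp
      then show ?thesis using s shrink[of k j] q \<sigma>_pos[OF pq(3)[of k]] by linarith
    qed
  qed
  obtain k where "norm (\<Xi> (p k) (u0 + f k (p k)) - \<Xi> (q k) (u0 + f k (q k))) \<le> real k * dist (p k) (q k)"
    using superposition_glued_lipschitz[where f = f and p = p and q = q and u = u0, OF S lip disj pq(1,2) off_p off_q]
    by blast
  with bad[of k] show False by (simp add: bad_def fp fq)
qed

text \<open>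
  The Lipschitz condition on cones with apex \<open>(x n, u n)\<close> gives suitable \<open>r\<close> and \<open>D\<close> for each single \<open>n\<close>,
  hence for all \<open>n \<le> m\<close> at once. If no choice serves all \<open>n\<close>, then for every \<open>k\<close> the choice \<open>(r, k)\<close>
  fails at arbitrarily late \<open>n\<close>, and the failures at distinct indices \<open>s k\<close> can be interpolated.
\<close>
lemma uniform_at_separated_necessary:
  fixes \<Xi> :: "'a::metric_space \<Rightarrow> 'b::banach \<Rightarrow> 'c::banach"
  assumes S: "\<forall>f\<in>Lip X. superposition \<Xi> f \<in> Lip X"
  shows "uniform_at_separated X \<Xi>"
  unfolding uniform_at_separated_def
proof (intro allI impI, elim conjE)
  fix x :: "nat \<Rightarrow> 'a" and u :: "nat \<Rightarrow> 'b" and C :: real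
  assume x: "range x \<subseteq> X" "separated_seq x" and u: "bounded (range u)"
  have xX: "x n \<in> X" for n using x by auto
  define good where "good r D n \<longleftrightarrow> (\<forall>y\<in>X. \<forall>v. norm (v - u n) \<le> C * dist y (x n) \<and> dist y (x n) \<le> r
      \<longrightarrow> norm (\<Xi> y v - \<Xi> (x n) (u n)) \<le> D * dist y (x n))" for r D n
  have good_mono: "good r' D' n" if "good r D n" "r' \<le> r" "D \<le> D'" for r r' D D' n
    using that unfolding good_def
    by (meson mult_right_mono order_trans zero_le_dist)
  have single: "\<exists>r>0. \<exists>D. good r D n" for n
  proof -
    obtain r D where r: "r > 0" and D: "\<And>x1 x2 u1 u2. x1 \<in> X \<Longrightarrow> x2 \<in> X \<Longrightarrow>
        norm (u1 - u2) \<le> C * dist x1 x2 \<Longrightarrow> norm (u1 - u n) \<le> C * dist x1 (x n) \<Longrightarrow>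
        norm (u2 - u n) \<le> C * dist x2 (x n) \<Longrightarrow> dist x1 (x n) \<le> r \<Longrightarrow> dist x2 (x n) \<le> r \<Longrightarrow>
        norm (\<Xi> x1 u1 - \<Xi> x2 u2) \<le> D * dist x1 x2"
      using lipschitz_on_conesE[OF lipschitz_on_cones_necessary[OF S] xX[of n], where ?u0.0 = "u n" and C = C]
      by blast
    have "good r D n"
      unfolding good_def using D[OF _ xX[of n], of _ _ "u n"] r by auto
    with r show ?thesis by blast
  qed
  have initial: "\<exists>r>0. \<exists>D. \<forall>n\<le>m. good r D n" for m
  proof (induction m)
    case 0
    then show ?case using single[of 0] by simp
  next
    case (Suc m)
    then obtain r D where r: "r > 0" "\<And>n. n \<le> m \<Longrightarrow> good r D n" by blast
    obtain r' D' where r': "r' > 0" "good r' D' (Suc m)" using single by blast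
    have "good (min r r') (max D D') n" if "n \<le> Suc m" for n
      using that good_mono[OF r(2)[of n], of "min r r'" "max D D'"]
        good_mono[OF r'(2), of "min r r'" "max D D'"] by (cases "n = Suc m") auto
    moreover have "min r r' > 0" using r r' by simp
    ultimately show ?case by blast
  qed
  have "\<exists>r>0. \<exists>D. \<forall>n. good r D n"
  proof (rule ccontr)
    assume no: "\<not> (\<exists>r>0. \<exists>D. \<forall>n. good r D n)"
    obtain \<delta> where \<delta>: "\<delta> > 0" "\<And>n m. n \<noteq> m \<Longrightarrow> \<delta> \<le> dist (x n) (x m)"
      using x(2) by (auto simp: separated_seq_iff)
    \<comment> \<open>The humps have support of radius \<open>2 * r\<close>, so this makes them disjoint.\<close>
    define r where "r = \<delta> / 4"
    have r: "r > 0" "\<And>n m. n \<noteq> m \<Longrightarrow> 4 * r \<le> dist (x n) (x m)" using \<delta> by (auto simp: r_def)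
    have "\<exists>n>m. \<not> good r (real k) n" for k m
    proof -
      obtain r' D where r': "r' > 0" "\<And>n. n \<le> m \<Longrightarrow> good r' D n" using initial by blast
      \<comment> \<open>The property only gets weaker as \<open>r\<close> shrinks and \<open>D\<close> grows, so it holds at all
        indices up to \<open>m\<close> and the failure is at a later one.\<close>
      have "min r r' > 0" using r r' by simp
      then obtain n where n: "\<not> good (min r r') (max (real k) D) n" using no by blast
      have "n > m" using n good_mono[OF r'(2), of n "min r r'" "max (real k) D"] by force
      moreover have "\<not> good r (real k) n"
        using n good_mono[of r "real k" n "min r r'" "max (real k) D"] by auto
      ultimately show ?thesis by blast
    qed
    then obtain s where s: "strict_mono s" and bad: "\<And>k. \<not> good r (real k) (s k)"
      using strict_mono_choice[of "\<lambda>k n. \<not> good r (real k) n"] by blast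
    from bad have "\<exists>y v. y \<in> X \<and> norm (v - u (s k)) \<le> C * dist y (x (s k)) \<and> dist y (x (s k)) \<le> r \<and>
        norm (\<Xi> y v - \<Xi> (x (s k)) (u (s k))) > real k * dist y (x (s k))" for k
      unfolding good_def by (meson not_le)
    then obtain y v where y: "\<And>k. y k \<in> X" "\<And>k. dist (y k) (x (s k)) \<le> r"
      and v: "\<And>k. norm (v k - u (s k)) \<le> C * dist (y k) (x (s k))"
      and big: "\<And>k. norm (\<Xi> (y k) (v k) - \<Xi> (x (s k)) (u (s k))) > real k * dist (y k) (x (s k))"
      by metis
    have ne: "y k \<noteq> x (s k)" for k using big[of k] v[of k] by auto
    have sep: "4 * r \<le> dist (x (s j)) (x (s k))" if "j \<noteq> k" for j k
      using r(2) s that by (simp add: strict_mono_eq)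
    obtain M where M: "\<And>n. norm (u n) \<le> M" using u by (auto simp: bounded_iff)
    have "\<exists>f. (M / r + C)-lipschitz_on X f \<and> f (x (s k)) = u (s k) \<and> f (y k) = v k \<and>
        (\<forall>z. f z \<noteq> 0 \<longrightarrow> dist z (x (s k)) < 2 * r)" for k
      using separated_hump[OF r(1) ne y(2) M v] by metis
    then obtain f where lip: "\<And>k. (M / r + C)-lipschitz_on X (f k)"
      and fx: "\<And>k. f k (x (s k)) = u (s k)" and fy: "\<And>k. f k (y k) = v k"
      and supp: "\<And>k z. f k z \<noteq> 0 \<Longrightarrow> dist z (x (s k)) < 2 * r"
      by metis
    have disj: "f j z = 0 \<or> f k z = 0" if "j \<noteq> k" for j k z
      using supp[of j z] supp[of k z] sep[OF that] dist_triangle3[of "x (s j)" "x (s k)" z] by force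
    have off_x: "f j (x (s k)) = 0" if "j \<noteq> k" for j k
      using supp[of j "x (s k)"] sep[OF that] r(1) by (force simp: dist_commute)
    have off_y: "f j (y k) = 0" if "j \<noteq> k" for j k
      using supp[of j "y k"] y(2)[of k] sep[OF that] dist_triangle3[of "x (s j)" "x (s k)" "y k"] r(1)
      by force
    obtain k where "norm (\<Xi> (y k) (0 + f k (y k)) - \<Xi> (x (s k)) (0 + f k (x (s k))))
        \<le> real k * dist (y k) (x (s k))"
      using superposition_glued_lipschitz[where f = f and p = y and q = "\<lambda>k. x (s k)" and u = 0,
          OF S lip disj y(1) xX off_y off_x] by blast
    with big[of k] show False by (simp add: fx fy)
  qed
  then show "\<exists>r>0. \<exists>D. \<forall>x' u'. range x' \<subseteq> X \<and>
      (\<forall>n. norm (u' n - u n) \<le> C * dist (x' n) (x n) \<and> dist (x' n) (x n) \<le> r) \<longrightarrow>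
      (\<forall>n. norm (\<Xi> (x' n) (u' n) - \<Xi> (x n) (u n)) \<le> D * dist (x' n) (x n))"
    unfolding good_def by (meson range_subsetD)
qed

section \<open>Sufficiency of the three conditions\<close>

text \<open>
  Points \<open>x k\<close> with \<open>\<parallel>Sf (x k)\<parallel> > k\<close> can neither converge to some \<open>l\<close>, since the graph of
  \<open>f\<close> lies in the cone with apex \<open>(l, f l)\<close> and there \<open>Sf\<close> is bounded near \<open>l\<close>, nor be separated,
  since \<open>f\<close> takes its values in a bounded set.
\<close>
lemma superposition_bounded:
  fixes \<Xi> :: "'a::metric_space \<Rightarrow> 'b::banach \<Rightarrow> 'c::banach"
  assumes "complete X" "bounded X" and fin: "bounded_off_finite X \<Xi>" and cone: "lipschitz_on_cones X \<Xi>"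
    and f: "f \<in> Lip X"
  shows "bounded (superposition \<Xi> f ` X)"
proof (rule ccontr)
  assume "\<not> bounded (superposition \<Xi> f ` X)"
  then have "\<exists>y\<in>superposition \<Xi> f ` X. norm y > real k" for k
    unfolding bounded_iff by (meson not_le)
  then have "\<exists>x\<in>X. norm (\<Xi> x (f x)) > real k" for k
    by (simp add: superposition_def)
  then obtain x where xX: "\<And>k. x k \<in> X" and big: "\<And>k. norm (\<Xi> (x k) (f (x k))) > real k" by metis
  obtain L where L: "L-lipschitz_on X f" using f by (auto simp: Lip_def)
  have unbounded: "norm (\<Xi> (x (s k)) (f (x (s k)))) > M" if "strict_mono s" "M \<le> real k" for s k M
    using big[of "s k"] strict_mono_imp_increasing[OF that(1), of k] that(2) by linarith
  have "range x \<subseteq> X" using xX by auto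
  with assms(1) show False
  proof (cases rule: convergent_or_separated_subseq)
    case (convergent s l)
    have fL: "norm (f x - f y) \<le> L * dist x y" if "x \<in> X" "y \<in> X" for x y
      using lipschitz_onD[OF L that] by (simp add: dist_norm)
    obtain r D where r: "r > 0" and rD: "\<And>x1 x2 u1 u2. x1 \<in> X \<Longrightarrow> x2 \<in> X \<Longrightarrow>
        norm (u1 - u2) \<le> L * dist x1 x2 \<Longrightarrow> norm (u1 - f l) \<le> L * dist x1 l \<Longrightarrow>
        norm (u2 - f l) \<le> L * dist x2 l \<Longrightarrow> dist x1 l \<le> r \<Longrightarrow> dist x2 l \<le> r \<Longrightarrow>
        norm (\<Xi> x1 u1 - \<Xi> x2 u2) \<le> D * dist x1 x2"
      using lipschitz_on_conesE[OF cone convergent(2), where ?u0.0 = "f l" and C = L] by blast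
    have D: "norm (\<Xi> y (f y) - \<Xi> l (f l)) \<le> D * dist y l" if "y \<in> X" "dist y l \<le> r" for y
      using rD[OF that(1) convergent(2), of "f y" "f l"] fL[OF that(1) convergent(2)] that(2) r
      by simp
    have "\<forall>\<^sub>F k in sequentially. dist (x (s k)) l < r"
      using tendstoD[OF convergent(3) r] by simp
    then obtain k0 where k0: "\<And>k. k \<ge> k0 \<Longrightarrow> dist (x (s k)) l < r" 
      by (auto simp: eventually_sequentially)
    define M where "M = norm (\<Xi> l (f l)) + \<bar>D\<bar> * r"
    have bd: "norm (\<Xi> (x (s k)) (f (x (s k)))) \<le> M" if "k \<ge> k0" for k
    proof -
      have "D * dist (x (s k)) l \<le> \<bar>D\<bar> * r"
        using k0[OF that] r by (intro mult_mono) auto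
      then show ?thesis
        using D[OF xX, of "s k"] k0[OF that] norm_triangle_sub[of "\<Xi> (x (s k)) (f (x (s k)))" "\<Xi> l (f l)"]
        by (auto simp: M_def)
    qed
    obtain k where "M \<le> real k" using real_arch_simple by blast
    then have "M \<le> real (max k k0)" by simp
    then show False using bd[of "max k k0"] unbounded[OF convergent(1)] by force
  next
    case (separated s)
    have "range (x \<circ> s) \<subseteq> X" using xX by auto
    then obtain N where "finite N" and bd: "bounded (\<Union>n\<in>-N. \<Xi> ((x \<circ> s) n) ` (f ` X))"
      using fin separated(2) Lip_image_bounded[OF f assms(2)] unfolding bounded_off_finite_def by blast
    obtain M where M: "\<And>n. n \<notin> N \<Longrightarrow> norm (\<Xi> (x (s n)) (f (x (s n)))) \<le> M"
      using bd xX by (auto simp: bounded_iff)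
    obtain m where m: "N \<subseteq> {..<m}" using \<open>finite N\<close> finite_nat_iff_bounded by blast
    obtain k where "M \<le> real k" using real_arch_simple by blast
    then have "M \<le> real (max k m)" by simp
    moreover have "max k m \<notin> N" using m by auto
    ultimately show False using M unbounded[OF separated(1)] by force
  qed
qed

text \<open>
  Boundedness of \<open>Sf\<close> reduces the Lipschitz estimate to pairs of points close to each other, and
  these are what the conditions on cones and on separated sequences control.
\<close>
lemma superposition_lipschitz:
  fixes \<Xi> :: "'a::metric_space \<Rightarrow> 'b::banach \<Rightarrow> 'c::banach"
  assumes "complete X" "bounded X" and fin: "bounded_off_finite X \<Xi>" and cone: "lipschitz_on_cones X \<Xi>"
    and unif: "uniform_at_separated X \<Xi>" and f: "f \<in> Lip X"
  shows "superposition \<Xi> f \<in> Lip X"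
proof (rule ccontr)
  assume no: "superposition \<Xi> f \<notin> Lip X"
  define g where "g x = \<Xi> x (f x)" for x
  have "\<exists>p\<in>X. \<exists>q\<in>X. norm (g p - g q) > real k * dist p q" for k
  proof (rule ccontr)
    assume "\<not> ?thesis"
    then have "(real k)-lipschitz_on X (superposition \<Xi> f)"
      by (intro lipschitz_onI) (auto simp: superposition_def g_def dist_norm not_less)
    with no show False by (auto simp: Lip_def)
  qed
  then obtain p q where pX: "\<And>k. p k \<in> X" and qX: "\<And>k. q k \<in> X"
    and big: "\<And>k. norm (g (p k) - g (q k)) > real k * dist (p k) (q k)" by metis
  obtain L where L: "L-lipschitz_on X f" using f by (auto simp: Lip_def)
  have fL: "norm (f x - f y) \<le> L * dist x y" if "x \<in> X" "y \<in> X" for x y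
    using lipschitz_onD[OF L that] by (simp add: dist_norm)
  obtain M where M: "\<And>x. x \<in> X \<Longrightarrow> norm (g x) \<le> M"
    using superposition_bounded[OF assms(1-4) f] by (auto simp: bounded_iff superposition_def g_def)
  have close: "\<exists>k0. \<forall>k\<ge>k0. dist (p k) (q k) < e" if "e > 0" for e
  proof -
    obtain k0 where k0: "2 * M / e < real k0" using reals_Archimedean2 by blast
    have "dist (p k) (q k) < e" if "k \<ge> k0" for k
    proof (rule ccontr)
      assume "\<not> dist (p k) (q k) < e"
      then have "real k0 * e \<le> real k * dist (p k) (q k)"
        using that \<open>e > 0\<close> by (intro mult_mono) auto
      also have "\<dots> < norm (g (p k) - g (q k))" by (rule big)
      also have "\<dots> \<le> 2 * M" using norm_triangle_ineq4[of "g (p k)" "g (q k)"] M[OF pX[of k]] M[OF qX[of k]] by linarith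
      finally show False using k0 \<open>e > 0\<close> by (simp add: field_simps)
    qed
    then show ?thesis by blast
  qed
  have steep: "norm (g (p (s k)) - g (q (s k))) > D * dist (p (s k)) (q (s k))"
    if "strict_mono s" "D \<le> real k" for s k D
  proof -
    have "D \<le> real (s k)" using strict_mono_imp_increasing[OF that(1), of k] that(2) by linarith
    then have "D * dist (p (s k)) (q (s k)) \<le> real (s k) * dist (p (s k)) (q (s k))"
      by (intro mult_right_mono) auto
    with big[of "s k"] show ?thesis by linarith
  qed
  have "range p \<subseteq> X" using pX by auto
  with assms(1) show False
  proof (cases rule: convergent_or_separated_subseq)
    case (convergent s l)
    obtain r D where r: "r > 0" and rD: "\<And>x1 x2 u1 u2. x1 \<in> X \<Longrightarrow> x2 \<in> X \<Longrightarrow>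
        norm (u1 - u2) \<le> L * dist x1 x2 \<Longrightarrow> norm (u1 - f l) \<le> L * dist x1 l \<Longrightarrow>
        norm (u2 - f l) \<le> L * dist x2 l \<Longrightarrow> dist x1 l \<le> r \<Longrightarrow> dist x2 l \<le> r \<Longrightarrow>
        norm (\<Xi> x1 u1 - \<Xi> x2 u2) \<le> D * dist x1 x2"
      using lipschitz_on_conesE[OF cone convergent(2), where ?u0.0 = "f l" and C = L] by blast
    have D: "norm (g y - g z) \<le> D * dist y z"
      if "y \<in> X" "z \<in> X" "dist y l \<le> r" "dist z l \<le> r" for y z
      unfolding g_def using that fL convergent(2) by (intro rD)
    have "\<forall>\<^sub>F k in sequentially. dist (p (s k)) l < r / 2"
      using tendstoD[OF convergent(3), of "r / 2"] r by simp
    then obtain k0 where k0: "\<And>k. k \<ge> k0 \<Longrightarrow> dist (p (s k)) l < r / 2" 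
      by (auto simp: eventually_sequentially)
    obtain k1 where k1: "\<And>k. k \<ge> k1 \<Longrightarrow> dist (p k) (q k) < r / 2" using close[of "r / 2"] r by auto
    obtain k2 where "D \<le> real k2" using real_arch_simple by blast
    then obtain k where k: "k \<ge> k0" "k \<ge> k1" "D \<le> real k"
      by (intro that[of "max k0 (max k1 k2)"]) auto
    have "s k \<ge> k1" using strict_mono_imp_increasing[OF convergent(1), of k] k(2) by linarith
    then have "dist (q (s k)) l \<le> r"
      using k0[OF k(1)] k1[of "s k"] dist_triangle3[of "q (s k)" l "p (s k)"] by linarith
    moreover have "dist (p (s k)) l \<le> r" using k0[OF k(1)] r by linarith
    ultimately show False using D[OF pX qX, of "s k" "s k"] steep[OF convergent(1) k(3)] by linarith
  next
    case (separated s)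
    have "range (p \<circ> s) \<subseteq> X" using pX by auto
    moreover have "bounded (range (f \<circ> (p \<circ> s)))"
      using Lip_image_bounded[OF f assms(2)] by (rule bounded_subset) (use pX in auto)
    ultimately have "\<exists>r>0. \<exists>D. \<forall>x' u'. range x' \<subseteq> X \<and>
      (\<forall>n. norm (u' n - (f \<circ> (p \<circ> s)) n) \<le> L * dist (x' n) ((p \<circ> s) n) \<and> dist (x' n) ((p \<circ> s) n) \<le> r) \<longrightarrow>
      (\<forall>n. norm (\<Xi> (x' n) (u' n) - \<Xi> ((p \<circ> s) n) ((f \<circ> (p \<circ> s)) n)) \<le> D * dist (x' n) ((p \<circ> s) n))"
      using unif separated(2) unfolding uniform_at_separated_def by blast
    then obtain r D where r: "r > 0" and D: "\<And>x' u' n. range x' \<subseteq> X \<Longrightarrow>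
      (\<And>n. norm (u' n - f (p (s n))) \<le> L * dist (x' n) (p (s n))) \<Longrightarrow>
      (\<And>n. dist (x' n) (p (s n)) \<le> r) \<Longrightarrow>
      norm (\<Xi> (x' n) (u' n) - \<Xi> (p (s n)) (f (p (s n)))) \<le> D * dist (x' n) (p (s n))"
      unfolding o_def by metis
    \<comment> \<open>The condition needs a perturbation of all terms; where \<open>q\<close> is still too far away, the
      trivial one is used.\<close>
    define x' where "x' n = (if dist (q (s n)) (p (s n)) \<le> r then q (s n) else p (s n))" for n
    have x'X: "x' n \<in> X" for n using pX qX by (simp add: x'_def)
    have x'_close: "dist (x' n) (p (s n)) \<le> r" for n using r by (simp add: x'_def)
    have lip': "norm (g (x' n) - g (p (s n))) \<le> D * dist (x' n) (p (s n))" for n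
      unfolding g_def
      by (rule D[of x' "\<lambda>n. f (x' n)"]) (use x'X fL[OF x'X pX] x'_close in auto)
    obtain k1 where k1: "\<And>k. k \<ge> k1 \<Longrightarrow> dist (p k) (q k) < r" using close[OF r] by auto
    obtain k2 where "D \<le> real k2" using real_arch_simple by blast
    then obtain k where k: "k \<ge> k1" "D \<le> real k" by (intro that[of "max k1 k2"]) auto
    have "s k \<ge> k1" using strict_mono_imp_increasing[OF separated(1), of k] k(1) by linarith
    then have "x' k = q (s k)" using k1[of "s k"] by (simp add: x'_def dist_commute)
    then show False using lip'[of k] steep[OF separated(1) k(2)]
      by (simp add: dist_commute norm_minus_commute)
  qed
qed

theorem theorem8p7:
  fixes X :: "'a::metric_space set"
    and \<Xi> :: "'a \<Rightarrow> 'b::banach \<Rightarrow> 'c::banach"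
  assumes "complete X" and "bounded X"
  shows "(\<forall>f\<in>Lip X. superposition \<Xi> f \<in> Lip X) \<longleftrightarrow>
    (\<forall>x B. range x \<subseteq> X \<and> separated_seq x \<and> bounded B \<longrightarrow>
       (\<exists>N. finite N \<and> bounded (\<Union>n\<in>-N. \<Xi> (x n) ` B))) \<and>
    (\<forall>x0\<in>X. \<forall>u0. \<forall>C::real. \<exists>r>0. \<exists>D::real.
       \<forall>x1\<in>X. \<forall>x2\<in>X. \<forall>u1 u2.
         norm (u1 - u2) \<le> C * dist x1 x2 \<and>
         norm (u1 - u0) \<le> C * dist x1 x0 \<and> norm (u2 - u0) \<le> C * dist x2 x0 \<and>
         dist x1 x0 \<le> r \<and> dist x2 x0 \<le> r \<longrightarrow>
         norm (\<Xi> x1 u1 - \<Xi> x2 u2) \<le> D * dist x1 x2) \<and>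
    (\<forall>x u. range x \<subseteq> X \<and> separated_seq x \<and> bounded (range u) \<longrightarrow>
       (\<forall>C::real. \<exists>r>0. \<exists>D::real. \<forall>x' u'.
         range x' \<subseteq> X \<and>
         (\<forall>n. norm (u' n - u n) \<le> C * dist (x' n) (x n) \<and> dist (x' n) (x n) \<le> r) \<longrightarrow>
         (\<forall>n. norm (\<Xi> (x' n) (u' n) - \<Xi> (x n) (u n)) \<le> D * dist (x' n) (x n))))"
  unfolding bounded_off_finite_def[symmetric] lipschitz_on_cones_def[symmetric]
    uniform_at_separated_def[symmetric]
  using superposition_lipschitz[OF assms] bounded_off_finite_necessary[OF assms(2)]
    lipschitz_on_cones_necessary uniform_at_separated_necessary
  by blast

end
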